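(* Let $S$ be a commutative ring with only trivial idempotents. Then for every integer $n \geq 2$ and every $n$-potent element $A \in M_2(S)$, $\det(A)$ is either $0$ or a unit in $S$. Furthermore, let $A$ and $B$ be tripotents in $M_2(S)$. Then the following hold: (1) If $\det(A) = \det(B) = 0$, then $\langle A,B\rangle_3$ is a unit in $M_2(S)$ if and only if $[A,B]_3^R$ and $[A,B]_3^L$ are both units in $M_2(S)$. (2) Suppose $\det(A)$ and $\det(B)$ are units in $S$. (a) If $[A,B]_2^L$ is a unit in $M_2(S)$, then $\langle A,B\rangle_3$ is a unit in $M_2(S)$ if and only if $[A,B]_3^R$ and $[A,B]_3^L$ are both units in $M_2(S)$. (b) If $[A,B]_2^L$ is not a unit in $M_2(S)$, then either $\langle A,B\rangle_3$ is not a unit in $M_2(S)$, or $[A,B]_3^R$ and $[A,B]_3^L$ are both non-units in $M_2(S)$. (3) Suppose $\det(A) = 0$ and $\det(B)$ is a unit in $S$. (a) If $A^2 - I - [A,B]_2^L$ and $A^2 - I - [A,B]_2^R$ are both units in $M_2(S)$, then $\langle A,B\rangle_3$ is a unit in $M_2(S)$ if and only if $[A,B]_3^R$ and $[A,B]_3^L$ are both units in $M_2(S)$. (b) If at least one of $A^2 - I - [A,B]_2^L$, $A^2 - I - [A,B]_2^R$ is not a unit in $M_2(S)$, then either $\langle A,B\rangle_3$ is not a unit in $M_2(S)$, or $[A,B]_3^R$ and $[A,B]_3^L$ are both non-units in $M_2(S)$. (4) Suppose $\det(B) = 0$ and $\det(A)$ is a unit in $S$. (a) If $-B^2 + I - [A,B]_2^L$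 and $-B^2 + I - [A,B]_2^R$ are both units in $M_2(S)$, then $\langle A,B\rangle_3$ is a unit in $M_2(S)$ if and only if $[A,B]_3^R$ and $[A,B]_3^L$ are both units in $M_2(S)$. (b) If at least one of $-B^2 + I - [A,B]_2^L$, $-B^2 + I - [A,B]_2^R$ is not a unit in $M_2(S)$, then either $\langle A,B\rangle_3$ is not a unit in $M_2(S)$, or $[A,B]_3^R$ and $[A,B]_3^L$ are both non-units in $M_2(S)$.
   Context: Rings are associative with unity. A ring has only trivial idempotents if its only idempotents are $0$ and $1$. An element $x$ of a ring is $n$-potent if $x^n = x$, and tripotent if $x^3 = x$. $M_2(S)$ is the ring of $2\times 2$ matrices over $S$ and $I$ is its identity matrix. For elements $a,b$ of a ring and an integer $d \geq 2$: $\langle a,b\rangle_d := (a+b)^d - a^d - b^d$, $[a,b]_d^L := (a-b)(a+b)^{d-1} - (a^d - b^d)$, and $[a,b]_d^R := (a+b)^{d-1}(a-b) - (a^d-b^d)$; in particular $[a,b]_2^L = ab-ba$ and $[a,b]_2^R = ba-ab$. "Either ... or" is inclusive. *)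

theory Defs
  imports "HOL-Algebra.Ring" "Jordan_Normal_Form.Determinant"
begin

definition only_trivial_idempotents :: "'a::comm_ring_1 itself \<Rightarrow> bool" where
  "only_trivial_idempotents _ \<longleftrightarrow> (\<forall>e::'a. e * e = e \<longrightarrow> e = 0 \<or> e = 1)"

text \<open>The notions below are for elements of an arbitrary, not necessarily commutative, ring.\<close>

definition potent :: "('a, 'm) ring_scheme \<Rightarrow> nat \<Rightarrow> 'a \<Rightarrow> bool" where
  "potent R n x \<longleftrightarrow> x \<in> carrier R \<and> x [^]\<^bsub>R\<^esub> n = x"

abbreviation tripotent :: "('a, 'm) ring_scheme \<Rightarrow> 'a \<Rightarrow> bool" where
  "tripotent R x \<equiv> potent R 3 x"

text \<open>The three brackets are meant for exponents \<open>d \<ge> 2\<close>.\<close>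

definition angle_bracket :: "('a, 'm) ring_scheme \<Rightarrow> nat \<Rightarrow> 'a \<Rightarrow> 'a \<Rightarrow> 'a" where
  "angle_bracket R d a b =
     (a \<oplus>\<^bsub>R\<^esub> b) [^]\<^bsub>R\<^esub> d \<ominus>\<^bsub>R\<^esub> a [^]\<^bsub>R\<^esub> d \<ominus>\<^bsub>R\<^esub> b [^]\<^bsub>R\<^esub> d"

definition bracket_left :: "('a, 'm) ring_scheme \<Rightarrow> nat \<Rightarrow> 'a \<Rightarrow> 'a \<Rightarrow> 'a" where
  "bracket_left R d a b =
     ((a \<ominus>\<^bsub>R\<^esub> b) \<otimes>\<^bsub>R\<^esub> (a \<oplus>\<^bsub>R\<^esub> b) [^]\<^bsub>R\<^esub> (d - 1))
       \<ominus>\<^bsub>R\<^esub> (a [^]\<^bsub>R\<^esub> d \<ominus>\<^bsub>R\<^esub> b [^]\<^bsub>R\<^esub> d)"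

definition bracket_right :: "('a, 'm) ring_scheme \<Rightarrow> nat \<Rightarrow> 'a \<Rightarrow> 'a \<Rightarrow> 'a" where
  "bracket_right R d a b =
     ((a \<oplus>\<^bsub>R\<^esub> b) [^]\<^bsub>R\<^esub> (d - 1) \<otimes>\<^bsub>R\<^esub> (a \<ominus>\<^bsub>R\<^esub> b))
       \<ominus>\<^bsub>R\<^esub> (a [^]\<^bsub>R\<^esub> d \<ominus>\<^bsub>R\<^esub> b [^]\<^bsub>R\<^esub> d)"

text \<open>
  The ring of 2 by 2 matrices over the ring given by the type argument. Its units are the
  library's \<open>Units\<close> of this ring, that is, the two-sided invertible elements of its carrier.
\<close>

abbreviation M2 :: "'a::comm_ring_1 itself \<Rightarrow> 'a mat ring" where
  "M2 ty \<equiv> ring_mat ty 2 ()"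

abbreviation is_unit_M2 :: "'a::comm_ring_1 mat \<Rightarrow> bool" where
  "is_unit_M2 X \<equiv> X \<in> Units (M2 TYPE('a))"

abbreviation angle_M2 :: "nat \<Rightarrow> 'a::comm_ring_1 mat \<Rightarrow> 'a mat \<Rightarrow> 'a mat" where
  "angle_M2 d A B \<equiv> angle_bracket (M2 TYPE('a)) d A B"

abbreviation bracket_left_M2 :: "nat \<Rightarrow> 'a::comm_ring_1 mat \<Rightarrow> 'a mat \<Rightarrow> 'a mat" where
  "bracket_left_M2 d A B \<equiv> bracket_left (M2 TYPE('a)) d A B"

abbreviation bracket_right_M2 :: "nat \<Rightarrow> 'a::comm_ring_1 mat \<Rightarrow> 'a mat \<Rightarrow> 'a mat" where
  "bracket_right_M2 d A B \<equiv> bracket_right (M2 TYPE('a)) d A B"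

end

theory Submission
  imports Defs
begin

text \<open>
  Everything rests on two factorisations that hold in any ring. If \<open>a\<close> and \<open>b\<close> are tripotents, then
  the cubes in the three brackets of exponent \<open>3\<close> collapse to first powers, so with
  \<open>c = (a + b)\<^sup>2 - 1\<close> the brackets are \<open>(a + b) c\<close>, \<open>(a - b) c\<close> and \<open>c (a - b)\<close>
  (\<open>ring.tripotent_bracket_factor\<close>). And for arbitrary \<open>a\<close> and \<open>b\<close>, the elements
  \<open>(a + b) (a - b)\<close> and \<open>(a - b) (a + b)\<close> are \<open>a\<^sup>2 - b\<^sup>2\<close> minus the left, respectively the right,
  bracket of exponent \<open>2\<close> (\<open>ring.sum_times_difference\<close>).

  A square matrix over a commutative ring is a unit iff its determinant is one, so only three
  determinants matter: \<open>p = det (A + B)\<close>, \<open>m = det (A - B)\<close> and \<open>d = det ((A + B)\<^sup>2 - I)\<close>.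
  The angle bracket is a unit iff \<open>p d\<close> is, and each of the other two is a unit iff \<open>m d\<close> is.

  If both tripotents are singular, the parallelogram law
  \<open>det (A + B) + det (A - B) = 2 (det A + det B)\<close> for 2 by 2 matrices gives \<open>p = - m\<close>, which is the
  first case. A tripotent with unit determinant is invertible and hence squares to \<open>I\<close>; therefore the
  matrices in the hypotheses of the remaining cases are, up to sign, exactly
  \<open>(A + B) (A - B)\<close> and \<open>(A - B) (A + B)\<close>. Such a hypothesis thus says that \<open>p\<close> and \<open>m\<close> are both
  units, or that one of them is not, and the claims are immediate.

  The dichotomy for determinants of potent matrices holds because \<open>x\<^sup>n = x\<close> makes \<open>x\<close> to the power
  \<open>n - 1\<close> an idempotent that fixes \<open>x\<close>.
\<close>

section \<open>Potent elements and determinants\<close>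

lemma potent_zero_or_unit:
  fixes d :: "'a::comm_ring_1"
  assumes "only_trivial_idempotents TYPE('a)" and "n \<ge> 2" and "d ^ n = d"
  shows "d = 0 \<or> d dvd 1"
proof -
  obtain m where n: "n = Suc (Suc m)"
    using assms(2) by (metis Suc_le_D numeral_2_eq_2 Suc_le_mono)
  let ?e = "d ^ Suc m"
  have d: "d * ?e = d"
    using assms(3) by (simp add: n)
  have "?e * ?e = d ^ m * (d * ?e)"
    by (simp add: ac_simps)
  also have "\<dots> = ?e"
    by (simp only: d) (simp add: ac_simps)
  finally have "?e = 0 \<or> ?e = 1"
    using assms(1) unfolding only_trivial_idempotents_def by blast
  then show ?thesis
  proof
    assume "?e = 0"
    then show ?thesis using d by simp
  next
    assume "?e = 1"
    then have "1 = d * d ^ m" by simp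
    then show ?thesis by (metis dvdI)
  qed
qed

lemma det_pow_mat:
  assumes "(A :: 'a::comm_ring_1 mat) \<in> carrier_mat n n"
  shows "det (A ^\<^sub>m k) = det A ^ k"
  using assms by (induction k) (simp_all add: det_mult[of _ n] ac_simps)

text \<open>
  Over a ring that is not a field, a unit determinant still yields an inverse, namely the adjugate
  divided by the determinant.
\<close>

lemma Units_ring_mat_iff_det:
  fixes A :: "'a::comm_ring_1 mat"
  assumes A: "A \<in> carrier_mat n n"
  shows "A \<in> Units (ring_mat TYPE('a) n b) \<longleftrightarrow> det A dvd 1"
proof
  assume "A \<in> Units (ring_mat TYPE('a) n b)"
  then obtain B where "B \<in> carrier_mat n n" "A * B = 1\<^sub>m n"
    by (auto simp: Units_def ring_mat_simps)
  then have "det A * det B = 1"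
    using det_mult[OF A] by (metis det_one)
  then show "det A dvd 1"
    by (metis dvdI)
next
  assume "det A dvd 1"
  then obtain u where u: "det A * u = 1"
    by (metis dvdE)
  let ?B = "u \<cdot>\<^sub>m adj_mat A"
  have B: "?B \<in> carrier_mat n n"
    using adj_mat(1)[OF A] by simp
  have smult: "u \<cdot>\<^sub>m (det A \<cdot>\<^sub>m 1\<^sub>m n) = 1\<^sub>m n"
    using u by (intro eq_matI) (auto simp: ac_simps)
  have "A * ?B = 1\<^sub>m n"
    using mult_smult_distrib[OF A adj_mat(1)[OF A]] adj_mat(2)[OF A] smult by simp
  moreover have "?B * A = 1\<^sub>m n"
    using mult_smult_assoc_mat[OF adj_mat(1)[OF A] A] adj_mat(3)[OF A] smult by simp
  ultimately show "A \<in> Units (ring_mat TYPE('a) n b)"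
    using A B by (auto simp: Units_def ring_mat_simps)
qed

lemma mult_Units_ring_mat_iff_det:
  fixes X Y :: "'a::comm_ring_1 mat"
  assumes "X \<in> carrier_mat n n" and "Y \<in> carrier_mat n n"
  shows "X * Y \<in> Units (ring_mat TYPE('a) n b) \<longleftrightarrow> det X dvd 1 \<and> det Y dvd 1"
  using assms Units_ring_mat_iff_det[of "X * Y" n b]
  by (simp add: det_mult is_unit_mult_iff)

lemma det_mat_2:
  assumes A: "(A :: 'a::comm_ring_1 mat) \<in> carrier_mat 2 2"
  shows "det A = A $$ (0,0) * A $$ (1,1) - A $$ (0,1) * A $$ (1,0)"
proof -
  have minor: "det (mat_delete A i 0) = A $$ (1 - i, 1)" if "i < 2" for i
  proof -
    have "mat_delete A i 0 \<in> carrier_mat 1 1"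
      using A by (auto simp: mat_delete_def)
    then have "det (mat_delete A i 0) = mat_delete A i 0 $$ (0,0)"
      by (rule det_single)
    then show ?thesis
      using A that by (auto simp: mat_delete_def less_2_cases_iff)
  qed
  have "det A = (\<Sum>i<2. A $$ (i,0) * cofactor A i 0)"
    using laplace_expansion_column[OF A, of 0] by simp
  then show ?thesis
    by (simp add: cofactor_def minor numeral_2_eq_2)
qed

text \<open>
  The determinant of 2 by 2 matrices is a quadratic form, so it obeys the parallelogram law.
\<close>

lemma det_parallelogram_2:
  fixes A B :: "'a::comm_ring_1 mat"
  assumes A: "A \<in> carrier_mat 2 2" and B: "B \<in> carrier_mat 2 2"
  shows "det (A + B) + det (A - B) = 2 * (det A + det B)"
proof -
  have diff: "A - B \<in> carrier_mat 2 2"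
    using B by (rule minus_carrier_mat)
  show ?thesis
    using A B
    by (simp add: det_mat_2[OF A] det_mat_2[OF B] det_mat_2[OF diff] det_mat_2[of "A + B"]
        algebra_simps)
qed

lemma det_singular_sum_unit_iff_difference:
  fixes A B :: "'a::comm_ring_1 mat"
  assumes "A \<in> carrier_mat 2 2" and "B \<in> carrier_mat 2 2"
    and "det A = 0" and "det B = 0"
  shows "det (A + B) dvd 1 \<longleftrightarrow> det (A - B) dvd 1"
proof -
  have "det (A - B) = - det (A + B)"
    using det_parallelogram_2[OF assms(1,2)] assms(3,4) by (simp add: add_eq_0_iff)
  then show ?thesis by simp
qed

section \<open>Factoring the brackets\<close>

context ring
begin

text \<open>
  Tripotence turns the subtracted cubes into \<open>a + b\<close> or \<open>a - b\<close>, which is a factor of the leading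
  product as well.
\<close>

lemma tripotent_bracket_factor:
  assumes a: "tripotent R a" and b: "tripotent R b"
  defines "c \<equiv> (a \<oplus> b) \<otimes> (a \<oplus> b) \<ominus> \<one>"
  shows "angle_bracket R 3 a b = (a \<oplus> b) \<otimes> c"
    and "bracket_left R 3 a b = (a \<ominus> b) \<otimes> c"
    and "bracket_right R 3 a b = c \<otimes> (a \<ominus> b)"
proof -
  have [simp]: "a \<in> carrier R" "b \<in> carrier R"
    and cubes: "a [^] (3::nat) = a" "b [^] (3::nat) = b"
    using a b by (auto simp: potent_def)
  define s where "s = a \<oplus> b"
  define m where "m = a \<ominus> b"
  have [simp]: "s \<in> carrier R" "m \<in> carrier R"
    by (simp_all add: s_def m_def)
  have pows: "s [^] (2::nat) = s \<otimes> s" "s [^] (3::nat) = s \<otimes> (s \<otimes> s)"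
    by (simp_all add: numeral_2_eq_2 numeral_3_eq_3 m_assoc)
  have expand: "x \<otimes> (s \<otimes> s \<ominus> \<one>) = x \<otimes> (s \<otimes> s) \<ominus> x"
    "(s \<otimes> s \<ominus> \<one>) \<otimes> x = s \<otimes> s \<otimes> x \<ominus> x" if "x \<in> carrier R" for x
    using that by (simp_all add: a_minus_def r_distr r_minus l_distr l_minus)
  have "s [^] (3::nat) \<ominus> a \<ominus> b = s [^] (3::nat) \<ominus> s"
    unfolding s_def by (simp add: a_minus_def minus_add a_assoc)
  then show "angle_bracket R 3 a b = (a \<oplus> b) \<otimes> c"
    unfolding angle_bracket_def cubes c_def s_def[symmetric] by (simp add: expand pows)
  show "bracket_left R 3 a b = (a \<ominus> b) \<otimes> c"
    and "bracket_right R 3 a b = c \<otimes> (a \<ominus> b)"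
    unfolding bracket_left_def bracket_right_def cubes c_def s_def[symmetric] m_def[symmetric]
    by (simp_all add: expand pows)
qed

lemma bracket_2_commutator:
  assumes [simp]: "a \<in> carrier R" "b \<in> carrier R"
  shows "bracket_left R 2 a b = a \<otimes> b \<ominus> b \<otimes> a"
    and "bracket_right R 2 a b = b \<otimes> a \<ominus> a \<otimes> b"
proof -
  have cancel: "(x \<oplus> z) \<oplus> (\<ominus> w \<oplus> \<ominus> y) \<ominus> (x \<ominus> y) = z \<ominus> w"
    if "x \<in> carrier R" "y \<in> carrier R" "z \<in> carrier R" "w \<in> carrier R" for x y z w
    using that by algebra
  note expand = numeral_2_eq_2 a_minus_def r_distr l_distr l_minus r_minus minus_add a_ac
  show "bracket_left R 2 a b = a \<otimes> b \<ominus> b \<otimes> a"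
    using cancel[of "a \<otimes> a" "b \<otimes> b" "a \<otimes> b" "b \<otimes> a"]
    by (simp add: bracket_left_def expand)
  show "bracket_right R 2 a b = b \<otimes> a \<ominus> a \<otimes> b"
    using cancel[of "a \<otimes> a" "b \<otimes> b" "b \<otimes> a" "a \<otimes> b"]
    by (simp add: bracket_right_def expand)
qed

text \<open>
  In a noncommutative ring the two products of \<open>a + b\<close> and \<open>a - b\<close> miss the difference of squares by
  a commutator; it is this defect that the brackets of exponent \<open>2\<close> measure.
\<close>

lemma sum_times_difference:
  assumes [simp]: "a \<in> carrier R" "b \<in> carrier R"
  shows "(a \<oplus> b) \<otimes> (a \<ominus> b) = a \<otimes> a \<ominus> b \<otimes> b \<ominus> bracket_left R 2 a b"
    and "(a \<ominus> b) \<otimes> (a \<oplus> b) = a \<otimes> a \<ominus> b \<otimes> b \<ominus> bracket_right R 2 a b"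
  unfolding bracket_2_commutator[OF assms]
  by (simp_all add: a_minus_def r_distr l_distr l_minus r_minus minus_add a_ac)

end

section \<open>Units among the brackets of matrices\<close>

lemma minus_ring_mat:
  assumes A: "A \<in> carrier_mat n n" and B: "B \<in> carrier_mat n n"
  shows "A \<ominus>\<^bsub>ring_mat TYPE('a::comm_ring_1) n b\<^esub> B = A - B"
proof -
  interpret ring "ring_mat TYPE('a) n b" by (rule ring_mat)
  have "\<ominus>\<^bsub>ring_mat TYPE('a) n b\<^esub> B = - B"
    using B by (intro minus_equality) (simp_all add: ring_mat_simps)
  then show ?thesis
    using add_uminus_minus_mat[OF A B] by (simp add: a_minus_def ring_mat_simps)
qed

lemma tripotent_det_unit_square:
  fixes A :: "'a::comm_ring_1 mat"
  assumes A: "tripotent (ring_mat TYPE('a) n b) A" and unit: "det A dvd 1"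
  shows "A * A = 1\<^sub>m n"
proof -
  let ?R = "ring_mat TYPE('a) n b"
  interpret ring ?R by (rule ring_mat)
  have carr: "A \<in> carrier ?R" and cube: "A [^]\<^bsub>?R\<^esub> (3::nat) = A"
    using A by (auto simp: potent_def)
  have "A \<in> Units ?R"
    using Units_ring_mat_iff_det[of A n b] carr unit by (simp add: ring_mat_simps)
  moreover have "A \<otimes>\<^bsub>?R\<^esub> (A \<otimes>\<^bsub>?R\<^esub> A) = A \<otimes>\<^bsub>?R\<^esub> \<one>\<^bsub>?R\<^esub>"
    using cube carr by (simp add: numeral_3_eq_3 m_assoc)
  ultimately have "A \<otimes>\<^bsub>?R\<^esub> A = \<one>\<^bsub>?R\<^esub>"
    using carr by (subst (asm) Units_l_cancel) auto
  then show ?thesis by (simp add: ring_mat_simps)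
qed

lemma bracket_units_iff_det:
  fixes A B :: "'a::comm_ring_1 mat" and n b
  defines "R \<equiv> ring_mat TYPE('a) n b"
  assumes A: "tripotent R A" and B: "tripotent R B"
  defines "c \<equiv> det ((A + B) * (A + B) - 1\<^sub>m n)"
  shows "angle_bracket R 3 A B \<in> Units R \<longleftrightarrow> det (A + B) dvd 1 \<and> c dvd 1"
    and "bracket_left R 3 A B \<in> Units R \<longleftrightarrow> det (A - B) dvd 1 \<and> c dvd 1"
    and "bracket_right R 3 A B \<in> Units R \<longleftrightarrow> det (A - B) dvd 1 \<and> c dvd 1"
proof -
  interpret ring R unfolding R_def by (rule ring_mat)
  have carr: "A \<in> carrier_mat n n" "B \<in> carrier_mat n n"
    using A B by (auto simp: potent_def R_def ring_mat_simps)
  let ?C = "(A + B) * (A + B) - 1\<^sub>m n"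
  have mats: "A + B \<in> carrier_mat n n" "A - B \<in> carrier_mat n n" "?C \<in> carrier_mat n n"
    using carr by (auto intro: minus_carrier_mat)
  have "angle_bracket R 3 A B = (A + B) * ?C"
    "bracket_left R 3 A B = (A - B) * ?C"
    "bracket_right R 3 A B = ?C * (A - B)"
    using tripotent_bracket_factor[OF A B] carr mult_carrier_mat[OF mats(1) mats(1)]
    by (simp_all add: R_def ring_mat_simps minus_ring_mat)
  then show "angle_bracket R 3 A B \<in> Units R \<longleftrightarrow> det (A + B) dvd 1 \<and> c dvd 1"
    and "bracket_left R 3 A B \<in> Units R \<longleftrightarrow> det (A - B) dvd 1 \<and> c dvd 1"
    and "bracket_right R 3 A B \<in> Units R \<longleftrightarrow> det (A - B) dvd 1 \<and> c dvd 1"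
    by (auto simp: R_def mult_Units_ring_mat_iff_det mats c_def)
qed

text \<open>
  The order of the factors in \<open>(A + B) (A - B)\<close> is invisible to the determinant, so the left and the
  right commutator give the same condition.
\<close>

lemma shifted_commutator_units_iff_det:
  fixes A B :: "'a::comm_ring_1 mat" and n b
  defines "R \<equiv> ring_mat TYPE('a) n b"
  assumes A: "A \<in> carrier_mat n n" and B: "B \<in> carrier_mat n n"
  shows "A * A - B * B - bracket_left R 2 A B \<in> Units R
      \<longleftrightarrow> det (A + B) dvd 1 \<and> det (A - B) dvd 1"
    and "A * A - B * B - bracket_right R 2 A B \<in> Units R
      \<longleftrightarrow> det (A + B) dvd 1 \<and> det (A - B) dvd 1"
proof -
  interpret ring R unfolding R_def by (rule ring_mat)
  have mats: "A + B \<in> carrier_mat n n" "A - B \<in> carrier_mat n n" "A * A - B * B \<in> carrier_mat n n"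
    using A B by (auto intro: minus_carrier_mat)
  have brackets: "bracket_left R 2 A B \<in> carrier_mat n n" "bracket_right R 2 A B \<in> carrier_mat n n"
    using bracket_2_commutator[of A B] A B
    by (auto simp: R_def ring_mat_simps minus_ring_mat intro: minus_carrier_mat)
  have "A * A - B * B - bracket_left R 2 A B = (A + B) * (A - B)"
    "A * A - B * B - bracket_right R 2 A B = (A - B) * (A + B)"
    using sum_times_difference[of A B] A B brackets mats
    by (simp_all add: R_def ring_mat_simps minus_ring_mat)
  then show "A * A - B * B - bracket_left R 2 A B \<in> Units R
      \<longleftrightarrow> det (A + B) dvd 1 \<and> det (A - B) dvd 1"
    and "A * A - B * B - bracket_right R 2 A B \<in> Units R
      \<longleftrightarrow> det (A + B) dvd 1 \<and> det (A - B) dvd 1"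
    by (auto simp: R_def mult_Units_ring_mat_iff_det mats)
qed

theorem theorem2p17:
  assumes "only_trivial_idempotents TYPE('a::comm_ring_1)"
  shows "(\<forall>n\<ge>2. \<forall>A :: 'a mat. potent (M2 TYPE('a)) n A \<longrightarrow> det A = 0 \<or> det A dvd 1) \<and>
    (\<forall>A B :: 'a mat. tripotent (M2 TYPE('a)) A \<longrightarrow> tripotent (M2 TYPE('a)) B \<longrightarrow>
      (det A = 0 \<and> det B = 0 \<longrightarrow>
          (is_unit_M2 (angle_M2 3 A B) \<longleftrightarrow>
          is_unit_M2 (bracket_right_M2 3 A B) \<and> is_unit_M2 (bracket_left_M2 3 A B))) \<and>
      (det A dvd 1 \<and> det B dvd 1 \<longrightarrow>
        (is_unit_M2 (bracket_left_M2 2 A B) \<longrightarrow>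
          (is_unit_M2 (angle_M2 3 A B) \<longleftrightarrow>
          is_unit_M2 (bracket_right_M2 3 A B) \<and> is_unit_M2 (bracket_left_M2 3 A B))) \<and>
        (\<not> is_unit_M2 (bracket_left_M2 2 A B) \<longrightarrow>
          \<not> is_unit_M2 (angle_M2 3 A B) \<or>
          \<not> is_unit_M2 (bracket_right_M2 3 A B) \<and> \<not> is_unit_M2 (bracket_left_M2 3 A B))) \<and>
      (det A = 0 \<and> det B dvd 1 \<longrightarrow>
        (is_unit_M2 (A ^\<^sub>m 2 - 1\<^sub>m 2 - bracket_left_M2 2 A B) \<and>
         is_unit_M2 (A ^\<^sub>m 2 - 1\<^sub>m 2 - bracket_right_M2 2 A B) \<longrightarrow>
          (is_unit_M2 (angle_M2 3 A B) \<longleftrightarrow>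
          is_unit_M2 (bracket_right_M2 3 A B) \<and> is_unit_M2 (bracket_left_M2 3 A B))) \<and>
        (\<not> is_unit_M2 (A ^\<^sub>m 2 - 1\<^sub>m 2 - bracket_left_M2 2 A B) \<or>
         \<not> is_unit_M2 (A ^\<^sub>m 2 - 1\<^sub>m 2 - bracket_right_M2 2 A B) \<longrightarrow>
          \<not> is_unit_M2 (angle_M2 3 A B) \<or>
          \<not> is_unit_M2 (bracket_right_M2 3 A B) \<and> \<not> is_unit_M2 (bracket_left_M2 3 A B))) \<and>
      (det B = 0 \<and> det A dvd 1 \<longrightarrow>
        (is_unit_M2 (- (B ^\<^sub>m 2) + 1\<^sub>m 2 - bracket_left_M2 2 A B) \<and>
         is_unit_M2 (- (B ^\<^sub>m 2) + 1\<^sub>m 2 - bracket_right_M2 2 A B) \<longrightarrow>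
          (is_unit_M2 (angle_M2 3 A B) \<longleftrightarrow>
          is_unit_M2 (bracket_right_M2 3 A B) \<and> is_unit_M2 (bracket_left_M2 3 A B))) \<and>
        (\<not> is_unit_M2 (- (B ^\<^sub>m 2) + 1\<^sub>m 2 - bracket_left_M2 2 A B) \<or>
         \<not> is_unit_M2 (- (B ^\<^sub>m 2) + 1\<^sub>m 2 - bracket_right_M2 2 A B) \<longrightarrow>
          \<not> is_unit_M2 (angle_M2 3 A B) \<or>
          \<not> is_unit_M2 (bracket_right_M2 3 A B) \<and> \<not> is_unit_M2 (bracket_left_M2 3 A B))))"
proof (rule conjI, goal_cases)
  case 1
  show ?case
  proof (intro allI impI)
    fix n :: nat and A :: "'a mat"
    assume n: "n \<ge> 2" and "potent (M2 TYPE('a)) n A"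
    then have "A \<in> carrier_mat 2 2" "A ^\<^sub>m n = A"
      using pow_mat_ring_pow[of A 2 n "()"] by (auto simp: potent_def ring_mat_simps)
    then have "det A ^ n = det A"
      using det_pow_mat by metis
    then show "det A = 0 \<or> det A dvd 1"
      using potent_zero_or_unit[OF assms n] by blast
  qed
next
  case 2
  show ?case
  proof (intro allI impI, goal_cases)
    case (1 A B)
    then have A: "A \<in> carrier_mat 2 2" and B: "B \<in> carrier_mat 2 2"
      by (auto simp: potent_def ring_mat_simps)
    let ?p = "det (A + B) dvd 1" and ?m = "det (A - B) dvd 1"
    let ?L = "bracket_left_M2 2 A B" and ?R = "bracket_right_M2 2 A B"
    note triple_brackets = bracket_units_iff_det[OF 1]
    note squares = tripotent_det_unit_square[OF 1(1)] tripotent_det_unit_square[OF 1(2)]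
    note shifted = shifted_commutator_units_iff_det[OF A B, of "()"]
    have pow2: "X ^\<^sub>m 2 = X * X" if "X \<in> carrier_mat 2 2" for X :: "'a mat"
      using that by (simp add: numeral_2_eq_2)
    have L: "?L \<in> carrier_mat 2 2"
      using ring.bracket_2_commutator(1)[OF ring_mat, of A 2 "()" B] A B
      by (auto simp: ring_mat_simps minus_ring_mat intro: minus_carrier_mat)
    have singular: "?p \<longleftrightarrow> ?m" if "det A = 0" "det B = 0"
      using det_singular_sum_unit_iff_difference[OF A B that] .
    have invertible: "is_unit_M2 ?L \<longleftrightarrow> ?p \<and> ?m" if "det A dvd 1" "det B dvd 1"
    proof -
      \<comment> \<open>Both squares are \<open>I\<close>, so the product \<open>(A + B) (A - B)\<close> is the negative of the commutator,
        and negation preserves 2 by 2 determinants.\<close>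
      have "A * A - B * B = 0\<^sub>m 2 2"
        using squares that by simp
      then have "is_unit_M2 (0\<^sub>m 2 2 - ?L) \<longleftrightarrow> ?p \<and> ?m"
        using shifted(1) by simp
      moreover have diff: "0\<^sub>m 2 2 - ?L \<in> carrier_mat 2 2"
        using L by (rule minus_carrier_mat)
      moreover have "det (0\<^sub>m 2 2 - ?L) = det ?L"
        using L by (simp add: det_mat_2[OF L] det_mat_2[OF diff])
      ultimately show ?thesis
        by (simp add: Units_ring_mat_iff_det L)
    qed
    have left: "is_unit_M2 (A ^\<^sub>m 2 - 1\<^sub>m 2 - ?L) \<longleftrightarrow> ?p \<and> ?m"
      "is_unit_M2 (A ^\<^sub>m 2 - 1\<^sub>m 2 - ?R) \<longleftrightarrow> ?p \<and> ?m" if "det B dvd 1"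
      using shifted squares(2)[OF that] by (simp_all add: pow2 A)
    have "- (B ^\<^sub>m 2) + 1\<^sub>m 2 = 1\<^sub>m 2 - B * B"
      using B by (intro eq_matI) (auto simp: pow2)
    then have right: "is_unit_M2 (- (B ^\<^sub>m 2) + 1\<^sub>m 2 - ?L) \<longleftrightarrow> ?p \<and> ?m"
      "is_unit_M2 (- (B ^\<^sub>m 2) + 1\<^sub>m 2 - ?R) \<longleftrightarrow> ?p \<and> ?m" if "det A dvd 1"
      using shifted squares(1)[OF that] by simp_all
    show ?case
      unfolding triple_brackets
      using singular invertible left right by (intro conjI impI; metis)
  qed
qed

end
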